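(* Let $C$ be a self-dual linear Kleinian code of length $n$ without codewords of weight $1$, and let $h(C')$ denote the minimal weight of its shadow $C'$. Then: (i) $C$ has at least $\frac{n}{2}(5-n)$ codewords of weight $2$; (ii) equality holds in (i) if and only if $h(C')=n-2$; (iii) in this case, the number of elements of weight $n-2$ in the shadow $C'$ is $2^{n-3}\cdot n$.
   Context: Let $K=\{0,a,b,c\}$ be the Kleinian four-group. A linear code of length $n$ is a subgroup $C\subseteq K^n$; $\mathrm{wt}(\mathbf{x})$ is the number of nonzero coordinates. Define $x\cdot y\in\mathbb{F}_2$ for $x,y\in K$ by $x\cdot y=1$ iff $x,y$ are nonzero and distinct; $(\mathbf{x},\mathbf{y})=\sum_ix_i\cdot y_i$; $C^\perp=\{\mathbf{x}:(\mathbf{x},\mathbf{y})=0\ \forall \mathbf{y}\in C\}$; $C$ is self-dual if $C=C^\perp$, even if all codewords have even weight. For a self-dual $C$, let $C_0$ be the subcode of even-weight codewords; the shadow is $C'=C_0^\perp\setminus C$ if $C$ is not even and $C'=C$ if $C$ is even; $h(C')=\min\{\mathrm{wt}(\mathbf{x}):\mathbf{x}\in C'\}$. *)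

theory Defs
  imports "HOL-Analysis.Finite_Cartesian_Product" "HOL-Library.Product_Plus" "HOL-Library.Z2"
begin

(* Z2 provides no finite instance for the two-element type bit; it makes the
   sets of vectors below, and hence their weights, finite. *)
instance bit :: finite
proof
  have "(UNIV :: bit set) = {0, 1}"
    using bit_not_zero_iff by auto
  then show "finite (UNIV :: bit set)"
    by (metis finite.emptyI finite.insertI)
qed

(* The Kleinian four-group K = {0,a,b,c}, written additively, as the direct sum of
   two groups of order 2. Words of length n are vectors in klein ^ 'n, n = CARD('n). *)
type_synonym klein = "bit \<times> bit"

definition klein_dot :: "klein \<Rightarrow> klein \<Rightarrow> bit" where
  "klein_dot x y = (if x \<noteq> 0 \<and> y \<noteq> 0 \<and> x \<noteq> y then 1 else 0)"

definition klein_form :: "klein ^ 'n::finite \<Rightarrow> klein ^ 'n \<Rightarrow> bit" where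
  "klein_form x y = (\<Sum>i\<in>UNIV. klein_dot (x $ i) (y $ i))"

definition wt :: "klein ^ 'n::finite \<Rightarrow> nat" where
  "wt x = card {i. x $ i \<noteq> 0}"

definition linear_code :: "(klein ^ 'n::finite) set \<Rightarrow> bool" where
  "linear_code C \<longleftrightarrow>
     0 \<in> C \<and> (\<forall>x\<in>C. \<forall>y\<in>C. x + y \<in> C) \<and> (\<forall>x\<in>C. - x \<in> C)"

definition dual :: "(klein ^ 'n::finite) set \<Rightarrow> (klein ^ 'n) set" where
  "dual C = {x. \<forall>y\<in>C. klein_form x y = 0}"

definition self_dual :: "(klein ^ 'n::finite) set \<Rightarrow> bool" where
  "self_dual C \<longleftrightarrow> C = dual C"

definition even_code :: "(klein ^ 'n::finite) set \<Rightarrow> bool" where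
  "even_code C \<longleftrightarrow> (\<forall>x\<in>C. even (wt x))"

definition even_subcode :: "(klein ^ 'n::finite) set \<Rightarrow> (klein ^ 'n) set" where
  "even_subcode C = {x \<in> C. even (wt x)}"

(* Only meaningful for self-dual C. *)
definition shadow :: "(klein ^ 'n::finite) set \<Rightarrow> (klein ^ 'n) set" where
  "shadow C = (if even_code C then C else dual (even_subcode C) - C)"

(* Min is unspecified on the empty set, but the shadow of a self-dual code is nonempty:
   if C is not even, the even subcode has index 2 in C, so its dual properly contains C. *)
definition min_wt :: "(klein ^ 'n::finite) set \<Rightarrow> nat" where
  "min_wt S = Min (wt ` S)"

end

theory Submission
  imports Defs
begin

(* The shadow is the set of vectors s whose pairing with C is the weight parity of C, so the
   indicator of the shadow is an average of characters over C and sums over the shadow become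
   sums over C.  Write Z(s) = n - wt s.  Summing (-1)^(wt s) shows that Z is even on the shadow
   S.  Counting the s in S that vanish on a set of at most two coordinates gives
   |S| = 2^n, the sum of Z over S, and the sum of Z^2 over S; together
     8 * (sum of Z(Z - 2) over S) = 2^n * (A_2 - n(5 - n)/2),
   where A_2 is the number of codewords of weight 2.  As Z is even, Z(Z - 2) >= 0, with
   equality iff Z is 0 or 2. *)

section \<open>Signs and characters on the Kleinian four-group and on words\<close>

definition bit_sign :: "bit \<Rightarrow> real" where
  "bit_sign b = (if b = 0 then 1 else - 1)"

lemma bit_sign_0 [simp]: "bit_sign 0 = 1"
  by (simp add: bit_sign_def)

lemma bit_sign_add: "bit_sign (a + b) = bit_sign a * bit_sign b"
  by (cases a; cases b) (simp_all add: bit_sign_def)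

lemma bit_sign_sum: "bit_sign (sum f A) = (\<Prod>i\<in>A. bit_sign (f i))"
proof (induction A rule: infinite_finite_induct)
  case (insert x A)
  then show ?case
    by (simp only: sum.insert prod.insert bit_sign_add not_False_eq_True)
qed simp_all

lemma UNIV_bit: "(UNIV :: bit set) = {0, 1}"
  using bit_not_zero_iff by auto

lemma UNIV_klein: "(UNIV :: klein set) = {(0, 0), (0, 1), (1, 0), (1, 1)}"
  unfolding UNIV_Times_UNIV[symmetric] UNIV_bit by auto

lemma klein_cases:
  fixes x :: klein
  obtains "x = (0, 0)" | "x = (0, 1)" | "x = (1, 0)" | "x = (1, 1)"
  using UNIV_klein by blast

lemma klein_dot_add_right: "klein_dot x (y + z) = klein_dot x y + klein_dot x z"
  by (cases x rule: klein_cases; cases y rule: klein_cases; cases z rule: klein_cases)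
    (simp_all add: klein_dot_def zero_prod_def)

definition klein_sign :: "klein \<Rightarrow> real" where
  "klein_sign x = (if x = 0 then 1 else - 1)"

text \<open>Being nonzero is a quadratic form on K, namely x1^2 + x1*x2 + x2^2 over F_2, and
  \<open>klein_dot\<close> is its polar form. Multiplied over the coordinates this becomes
  \<open>wt_sign_add\<close>.\<close>

lemma klein_sign_add:
  "klein_sign (x + y) = klein_sign x * klein_sign y * bit_sign (klein_dot x y)"
  by (cases x rule: klein_cases; cases y rule: klein_cases)
    (simp_all add: klein_dot_def zero_prod_def klein_sign_def bit_sign_def)

text \<open>If \<open>y\<close> is nonzero, exactly 0 and \<open>y\<close> pair to 0 with it and the
  other two elements pair to 1, so the signs cancel.\<close>

lemma sum_bit_sign_klein_dot:
  "(\<Sum>x\<in>UNIV. bit_sign (klein_dot x y)) = (if y = 0 then 4 else 0)"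
  by (cases y rule: klein_cases)
    (simp_all add: UNIV_klein klein_dot_def zero_prod_def bit_sign_def)

text \<open>The Gauss sum of K: \<open>klein_sign\<close> is an eigenvector of the character
  transform with eigenvalue -2. At \<open>y = 0\<close> the sum is 1 - 3.\<close>

lemma sum_klein_sign_bit_sign:
  "(\<Sum>x\<in>UNIV. klein_sign x * bit_sign (klein_dot x y)) = - 2 * klein_sign y"
  by (cases y rule: klein_cases)
    (simp_all add: UNIV_klein klein_dot_def zero_prod_def bit_sign_def klein_sign_def)

lemma bit_sign_klein_form:
  "bit_sign (klein_form x y) = (\<Prod>i\<in>UNIV. bit_sign (klein_dot (x $ i) (y $ i)))"
  by (simp add: klein_form_def bit_sign_sum)

lemma klein_form_add_right: "klein_form x (y + z) = klein_form x y + klein_form x z"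
  by (simp only: klein_form_def vector_add_component klein_dot_add_right sum.distrib)

definition wt_sign :: "klein ^ 'n::finite \<Rightarrow> real" where
  "wt_sign x = (- 1) ^ wt x"

lemma wt_sign_eq_prod: "wt_sign x = (\<Prod>i\<in>UNIV. klein_sign (x $ i))"
proof -
  have "(\<Prod>i\<in>UNIV. klein_sign (x $ i)) = (\<Prod>i\<in>{i. x $ i \<noteq> 0}. - 1)"
    unfolding klein_sign_def by (subst prod.If_cases) (auto simp: Collect_neg_eq)
  then show ?thesis
    by (simp add: wt_sign_def wt_def)
qed

lemma wt_sign_add: "wt_sign (x + y) = wt_sign x * wt_sign y * bit_sign (klein_form x y)"
  by (simp add: wt_sign_eq_prod bit_sign_klein_form klein_sign_add prod.distrib)

lemma wt_sign_square [simp]: "wt_sign x * wt_sign x = 1"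
  by (simp add: wt_sign_def flip: power_add)

lemma wt_sign_eq_1_iff: "wt_sign x = 1 \<longleftrightarrow> even (wt x)"
  by (auto simp: wt_sign_def minus_one_power_iff)

section \<open>Character sums over the whole space and over codes\<close>

lemma sum_vec_prod:
  fixes f :: "'n::finite \<Rightarrow> 'a::finite \<Rightarrow> real"
  shows "(\<Sum>x\<in>UNIV. \<Prod>i\<in>UNIV. f i (x $ i)) = (\<Prod>i\<in>UNIV. \<Sum>k\<in>UNIV. f i k)"
proof -
  have "(\<Prod>i\<in>UNIV. \<Sum>k\<in>UNIV. f i k) = (\<Sum>g\<in>UNIV. \<Prod>i\<in>UNIV. f i (g i))"
    by (subst prod_sum_PiE) (auto simp: PiE_UNIV_domain)
  also have "\<dots> = (\<Sum>x\<in>UNIV. \<Prod>i\<in>UNIV. f i (x $ i))"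
    by (rule sum.reindex_bij_witness[of _ vec_nth vec_lambda]) auto
  finally show ?thesis ..
qed

text \<open>Orthogonality of characters: translation by some \<open>a\<close> with
  \<open>\<psi> a \<noteq> 1\<close> permutes \<open>C\<close> but multiplies the sum by
  \<open>\<psi> a\<close>, which forces the sum to be 0.\<close>

lemma sum_linear_code_character:
  fixes C :: "(klein ^ 'n::finite) set" and \<psi> :: "klein ^ 'n \<Rightarrow> real"
  assumes C: "linear_code C"
    and \<psi>: "\<And>x y. x \<in> C \<Longrightarrow> y \<in> C \<Longrightarrow> \<psi> (x + y) = \<psi> x * \<psi> y"
  shows "sum \<psi> C = (if \<forall>x\<in>C. \<psi> x = 1 then real (card C) else 0)"
proof (cases "\<forall>x\<in>C. \<psi> x = 1")
  case False
  then obtain a where a: "a \<in> C" "\<psi> a \<noteq> 1"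
    by blast
  have "sum \<psi> C = (\<Sum>c\<in>C. \<psi> (a + c))"
    by (rule sum.reindex_bij_witness[of _ "\<lambda>c. a + c" "\<lambda>c. - a + c"])
      (use C a in \<open>auto simp: linear_code_def simp del: uminus_add_conv_diff\<close>)
  also have "\<dots> = \<psi> a * sum \<psi> C"
    by (simp add: \<psi> a sum_distrib_left)
  finally have "sum \<psi> C = 0"
    using a(2) by (metis mult_cancel_right1)
  then show ?thesis
    using False by auto
qed simp

section \<open>Sums over the shadow as character sums over the code\<close>

text \<open>The form vanishes on a self-dual code, so weight parity is additive there and
  \<open>wt_sign\<close> is a character of \<open>C\<close>. The shadow consists of the vectors
  representing this character, whether or not \<open>C\<close> is even.\<close>

lemma in_shadow_iff:
  assumes C: "linear_code C" and sd: "self_dual C"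
  shows "s \<in> shadow C \<longleftrightarrow> (\<forall>c\<in>C. wt_sign c * bit_sign (klein_form s c) = 1)"
proof (cases "even_code C")
  case True
  then have "wt_sign c = 1" if "c \<in> C" for c
    using that by (auto simp: even_code_def wt_sign_eq_1_iff)
  then have "(\<forall>c\<in>C. wt_sign c * bit_sign (klein_form s c) = 1) \<longleftrightarrow> s \<in> dual C"
    by (auto simp: dual_def bit_sign_def split: if_splits)
  then show ?thesis
    using True sd by (simp add: shadow_def self_dual_def)
next
  case False
  then obtain d where d: "d \<in> C" "odd (wt d)"
    by (auto simp: even_code_def)
  have mem: "s \<in> C \<longleftrightarrow> (\<forall>c\<in>C. klein_form s c = 0)"
    using sd by (auto simp: self_dual_def dual_def)
  have orth: "klein_form x y = 0" if "x \<in> C" "y \<in> C" for x y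
    using sd that unfolding self_dual_def dual_def by blast
  have add: "x + y \<in> C" if "x \<in> C" "y \<in> C" for x y
    using C that by (simp add: linear_code_def)
  have sgn: "wt_sign c = (if even (wt c) then 1 else - 1)" for c :: "klein ^ 'a"
    by (simp add: wt_sign_def)
  show ?thesis
  proof
    assume "s \<in> shadow C"
    then have s0: "klein_form s c = 0" if "c \<in> C" "even (wt c)" for c
      using False that by (auto simp: shadow_def dual_def even_subcode_def)
    have "s \<notin> C"
      using \<open>s \<in> shadow C\<close> False by (auto simp: shadow_def)
    then obtain e where e: "e \<in> C" "klein_form s e \<noteq> 0"
      using mem by blast
    then have "odd (wt e)"
      using s0 by blast
    show "\<forall>c\<in>C. wt_sign c * bit_sign (klein_form s c) = 1"
    proof
      fix c assume c: "c \<in> C"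
      show "wt_sign c * bit_sign (klein_form s c) = 1"
      proof (cases "even (wt c)")
        case True
        then show ?thesis
          using s0[OF c] by (simp add: sgn)
      next
        case False
        \<comment> \<open>The sum of two orthogonal words of odd weight has even weight. So
          \<open>s\<close> is orthogonal to \<open>e + c\<close> and pairs with \<open>c\<close> as
          it does with \<open>e\<close>, that is, to 1.\<close>
        have "wt_sign (e + c) = 1"
          unfolding wt_sign_add using False \<open>odd (wt e)\<close> orth[OF e(1) c]
          by (simp add: sgn)
        then have "klein_form s (e + c) = 0"
          by (intro s0 add e c) (simp add: wt_sign_eq_1_iff)
        then have "bit_sign (klein_form s e) * bit_sign (klein_form s c) = 1"
          by (metis bit_sign_0 bit_sign_add klein_form_add_right)
        then show ?thesis
          using False e(2) by (simp add: sgn bit_sign_def)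
      qed
    qed
  next
    assume *: "\<forall>c\<in>C. wt_sign c * bit_sign (klein_form s c) = 1"
    \<comment> \<open>\<open>s\<close> pairs to 1 with the odd word \<open>d\<close>, whereas every
      codeword is orthogonal to \<open>d\<close>.\<close>
    have "s \<notin> C"
      using * d orth by (force simp: sgn)
    moreover have "klein_form s c = 0" if "c \<in> C" "even (wt c)" for c
      using *[rule_format, OF that(1)] that(2) by (auto simp: sgn bit_sign_def split: if_splits)
    ultimately show "s \<in> shadow C"
      using False by (auto simp: shadow_def dual_def even_subcode_def)
  qed
qed

text \<open>Sum the signs of the form over all pairs of a vector and a codeword. Summing over
  codewords first leaves only the vectors in \<open>C\<close> and gives the square of
  \<open>card C\<close>; summing over vectors first leaves only the zero word and gives 4^n.\<close>

lemma card_self_dual: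
  fixes C :: "(klein ^ 'n::finite) set"
  assumes C: "linear_code C" and sd: "self_dual C"
  shows "card C = 2 ^ CARD('n)"
proof -
  have *: "(\<Sum>c\<in>C. bit_sign (klein_form s c)) = (if s \<in> C then real (card C) else 0)" for s
  proof -
    have "s \<in> C \<longleftrightarrow> (\<forall>c\<in>C. bit_sign (klein_form s c) = 1)"
      using sd by (auto simp: self_dual_def dual_def bit_sign_def split: if_splits)
    then show ?thesis
      by (subst sum_linear_code_character[OF C]) (simp_all only: klein_form_add_right bit_sign_add)
  qed
  have **: "(\<Sum>s\<in>UNIV. bit_sign (klein_form s c)) = (if c = 0 then 4 ^ CARD('n) else 0)"
    for c :: "klein ^ 'n"
  proof -
    have "(\<Sum>s\<in>UNIV. bit_sign (klein_form s c)) = (\<Prod>i\<in>UNIV. if c $ i = 0 then 4 else 0)"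
      unfolding bit_sign_klein_form
      by (subst sum_vec_prod[of "\<lambda>i k. bit_sign (klein_dot k (c $ i))"])
        (simp add: sum_bit_sign_klein_dot)
    also have "\<dots> = (if c = 0 then 4 ^ CARD('n) else 0)"
      by (auto simp: vec_eq_iff)
    finally show ?thesis .
  qed
  have "real (card C) * real (card C) = (\<Sum>s\<in>UNIV. \<Sum>c\<in>C. bit_sign (klein_form s c))"
    by (simp add: * sum.If_cases)
  also have "\<dots> = (\<Sum>c\<in>C. \<Sum>s\<in>UNIV. bit_sign (klein_form s c))"
    by (rule sum.swap)
  also have "\<dots> = 4 ^ CARD('n)"
    using C by (simp add: ** sum.delta linear_code_def)
  also have "\<dots> = (2 ^ CARD('n)) ^ 2"
    by (simp add: power2_eq_square flip: power_mult_distrib)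
  finally have "real (card C) = 2 ^ CARD('n)"
    by (simp add: power2_eq_square[symmetric])
  then show ?thesis
    by (metis of_nat_eq_iff of_nat_numeral of_nat_power)
qed

text \<open>By \<open>in_shadow_iff\<close> and orthogonality, 2^n times the indicator of the shadow
  is a sum of characters over \<open>C\<close>. Exchanging the two sums yields a Poisson summation
  formula.\<close>

lemma sum_shadow:
  fixes C :: "(klein ^ 'n::finite) set" and f :: "klein ^ 'n \<Rightarrow> real"
  assumes C: "linear_code C" and sd: "self_dual C"
  shows "2 ^ CARD('n) * sum f (shadow C)
    = (\<Sum>c\<in>C. wt_sign c * (\<Sum>s\<in>UNIV. f s * bit_sign (klein_form s c)))"
proof -
  have *: "(\<Sum>c\<in>C. wt_sign c * bit_sign (klein_form s c))
      = (if s \<in> shadow C then 2 ^ CARD('n) else 0)" for s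
  proof -
    have "wt_sign (c + d) = wt_sign c * wt_sign d" if "c \<in> C" "d \<in> C" for c d
      using sd that by (force simp: wt_sign_add self_dual_def dual_def)
    then have "wt_sign (c + d) * bit_sign (klein_form s (c + d))
        = (wt_sign c * bit_sign (klein_form s c)) * (wt_sign d * bit_sign (klein_form s d))"
      if "c \<in> C" "d \<in> C" for c d
      using that by (simp only: klein_form_add_right bit_sign_add mult_ac)
    then show ?thesis
      by (subst sum_linear_code_character[OF C])
        (simp_all add: in_shadow_iff[OF C sd] card_self_dual[OF C sd])
  qed
  have "2 ^ CARD('n) * sum f (shadow C)
      = (\<Sum>s\<in>UNIV. f s * (if s \<in> shadow C then 2 ^ CARD('n) else 0))"
    by (simp add: sum.If_cases if_distrib sum_distrib_right mult.commute cong: if_cong)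
  also have "\<dots> = (\<Sum>s\<in>UNIV. \<Sum>c\<in>C. f s * (wt_sign c * bit_sign (klein_form s c)))"
    by (simp only: *[symmetric] sum_distrib_left)
  also have "\<dots> = (\<Sum>c\<in>C. wt_sign c * (\<Sum>s\<in>UNIV. f s * bit_sign (klein_form s c)))"
    by (subst sum.swap) (simp add: sum_distrib_left mult_ac)
  finally show ?thesis .
qed

text \<open>Apply \<open>sum_shadow\<close> to the indicator of the vectors vanishing on
  \<open>T\<close>: its character transform is concentrated on the words supported inside
  \<open>T\<close>. The factor \<open>4 ^ card T\<close> clears denominators.\<close>

lemma card_shadow_vanishing:
  fixes C :: "(klein ^ 'n::finite) set"
  assumes C: "linear_code C" and sd: "self_dual C"
  shows "4 ^ card T * real (card {s \<in> shadow C. \<forall>i\<in>T. s $ i = 0})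
    = 2 ^ CARD('n) * (\<Sum>c | c \<in> C \<and> {i. c $ i \<noteq> 0} \<subseteq> T. wt_sign c)"
proof -
  \<comment> \<open>Written as a product over coordinates so that \<open>sum_vec_prod\<close>
    applies.\<close>
  define f :: "klein ^ 'n \<Rightarrow> real" where
    "f s = (\<Prod>i\<in>UNIV. if i \<in> T \<and> s $ i \<noteq> 0 then 0 else 1)" for s
  have f: "f s = (if \<forall>i\<in>T. s $ i = 0 then 1 else 0)" for s
    by (auto simp: f_def intro!: prod.neutral)
  have inner: "4 ^ card T * (\<Sum>s\<in>UNIV. f s * bit_sign (klein_form s c))
      = (if {i. c $ i \<noteq> 0} \<subseteq> T then 4 ^ CARD('n) else 0)" for c
  proof -
    have loc: "(\<Sum>k\<in>UNIV. (if i \<in> T \<and> k \<noteq> 0 then 0 else 1) * bit_sign (klein_dot k (c $ i)))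
        = (if i \<in> T then 1 else if c $ i = 0 then 4 else 0)" for i
    proof (cases "i \<in> T")
      case True
      then have "(\<Sum>k\<in>UNIV. (if i \<in> T \<and> k \<noteq> 0 then 0 else 1) * bit_sign (klein_dot k (c $ i)))
          = (\<Sum>k\<in>(UNIV :: klein set). if k = 0 then 1 else 0)"
        by (intro sum.cong) (simp_all add: klein_dot_def)
      then show ?thesis
        using True by simp
    qed (simp add: sum_bit_sign_klein_dot)
    have "(\<Sum>s\<in>UNIV. f s * bit_sign (klein_form s c))
        = (\<Sum>s\<in>UNIV. \<Prod>i\<in>UNIV. (if i \<in> T \<and> s $ i \<noteq> 0 then 0 else 1)
            * bit_sign (klein_dot (s $ i) (c $ i)))"
      by (simp add: f_def bit_sign_klein_form prod.distrib)
    also have "\<dots> = (\<Prod>i\<in>UNIV. if i \<in> T then 1 else if c $ i = 0 then 4 else 0)"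
      by (subst sum_vec_prod[of "\<lambda>i k. (if i \<in> T \<and> k \<noteq> 0 then 0 else 1)
          * bit_sign (klein_dot k (c $ i))"]) (simp add: loc)
    \<comment> \<open>Spreading the factor over the coordinates in \<open>T\<close> makes every
      coordinate contribute 4, except those outside \<open>T\<close> where \<open>c\<close> is
      nonzero.\<close>
    finally have "4 ^ card T * (\<Sum>s\<in>UNIV. f s * bit_sign (klein_form s c))
        = (\<Prod>i\<in>UNIV. if i \<in> T then 4 else 1)
        * (\<Prod>i\<in>UNIV. if i \<in> T then 1 else if c $ i = 0 then 4 else 0)"
      by (simp add: prod.If_cases)
    also have "\<dots> = (\<Prod>i\<in>UNIV. if i \<in> T \<or> c $ i = 0 then 4 else 0)"
      by (subst prod.distrib[symmetric], intro prod.cong) auto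
    also have "\<dots> = (if {i. c $ i \<noteq> 0} \<subseteq> T then 4 ^ CARD('n) else 0)"
    proof (cases "{i. c $ i \<noteq> 0} \<subseteq> T")
      case True
      then have "(\<Prod>i\<in>UNIV. if i \<in> T \<or> c $ i = 0 then 4 else (0::real)) = (\<Prod>i\<in>(UNIV::'n set). 4)"
        by (intro prod.cong) auto
      then show ?thesis
        using True by simp
    qed (auto intro!: prod_zero)
    finally show ?thesis .
  qed
  have "2 ^ CARD('n) * (4 ^ card T * real (card {s \<in> shadow C. \<forall>i\<in>T. s $ i = 0}))
      = 4 ^ card T * (2 ^ CARD('n) * sum f (shadow C))"
    by (simp add: f sum.If_cases Int_def)
  also have "\<dots> = (\<Sum>c\<in>C. wt_sign c * (4 ^ card T * (\<Sum>s\<in>UNIV. f s * bit_sign (klein_form s c))))"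
    unfolding sum_shadow[OF C sd] by (simp add: sum_distrib_left mult_ac)
  also have "\<dots> = (\<Sum>c\<in>C. if {i. c $ i \<noteq> 0} \<subseteq> T then wt_sign c * 4 ^ CARD('n) else 0)"
    unfolding inner by (intro sum.cong) auto
  also have "\<dots> = (\<Sum>c | c \<in> C \<and> {i. c $ i \<noteq> 0} \<subseteq> T. wt_sign c) * 4 ^ CARD('n)"
    by (simp add: sum.If_cases Int_def sum_distrib_right)
  also have "(4::real) ^ CARD('n) = 2 ^ CARD('n) * 2 ^ CARD('n)"
    by (simp flip: power_mult_distrib)
  finally show ?thesis
    by simp
qed

lemma card_shadow:
  fixes C :: "(klein ^ 'n::finite) set"
  assumes C: "linear_code C" and sd: "self_dual C"
  shows "card (shadow C) = 2 ^ CARD('n)"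
proof -
  have "{c. c \<in> C \<and> {i. c $ i \<noteq> 0} \<subseteq> {}} = {0}"
    using C by (auto simp: linear_code_def vec_eq_iff)
  then have "real (card (shadow C)) = 2 ^ CARD('n)"
    using card_shadow_vanishing[OF C sd, of "{}"] by (simp add: wt_sign_def wt_def)
  then show ?thesis
    by (metis of_nat_eq_iff of_nat_numeral of_nat_power)
qed

section \<open>The number of zero coordinates: parity on the shadow and double counting\<close>

definition zeros :: "klein ^ 'n::finite \<Rightarrow> nat" where
  "zeros x = card {i. x $ i = 0}"

lemma wt_plus_zeros: "wt x + zeros x = CARD('n)" for x :: "klein ^ 'n::finite"
proof -
  have "wt x + zeros x = card ({i. x $ i \<noteq> 0} \<union> {i. x $ i = 0})"
    unfolding wt_def zeros_def by (rule card_Un_disjoint[symmetric]) auto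
  also have "{i. x $ i \<noteq> 0} \<union> {i. x $ i = 0} = UNIV"
    by auto
  finally show ?thesis .
qed

(* The Gauss sum of (-1)^wt over all vectors is (-2)^n; as the shadow has 2^n elements, all of
   them contribute the same sign. *)

lemma even_zeros_shadow:
  fixes C :: "(klein ^ 'n::finite) set"
  assumes C: "linear_code C" and sd: "self_dual C" and s: "s \<in> shadow C"
  shows "even (zeros s)"
proof -
  let ?S = "shadow C"
  have gauss: "(\<Sum>s\<in>UNIV. wt_sign s * bit_sign (klein_form s c)) = (- 2) ^ CARD('n) * wt_sign c"
    for c :: "klein ^ 'n"
    unfolding bit_sign_klein_form wt_sign_eq_prod prod.distrib[symmetric]
    by (subst sum_vec_prod[of "\<lambda>i k. klein_sign k * bit_sign (klein_dot k (c $ i))"])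
      (simp only: sum_klein_sign_bit_sign prod.distrib prod_constant)
  have "2 ^ CARD('n) * (\<Sum>s\<in>?S. wt_sign s)
      = (\<Sum>c\<in>C. (- 2) ^ CARD('n) * (wt_sign c * wt_sign c))"
    unfolding sum_shadow[OF C sd] gauss by (simp only: mult.left_commute)
  then have "(\<Sum>s\<in>?S. wt_sign s) = (- 2) ^ CARD('n)"
    by (simp add: card_self_dual[OF C sd])
  then have "(\<Sum>s\<in>?S. (- 1) ^ CARD('n) * wt_sign s) = 2 ^ CARD('n)"
    by (simp add: sum_distrib_left[symmetric] flip: power_mult_distrib)
  then have "(\<Sum>s\<in>?S. 1 - (- 1) ^ CARD('n) * wt_sign s) = 0"
    by (simp add: sum_subtractf card_shadow[OF C sd])
  moreover have "0 \<le> 1 - (- 1) ^ CARD('n) * wt_sign t" for t :: "klein ^ 'n"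
    by (auto simp: wt_sign_def minus_one_power_iff)
  ultimately have "1 - (- 1) ^ CARD('n) * wt_sign s = 0"
    using s by (subst (asm) sum_nonneg_eq_0_iff) auto
  then have "even (CARD('n) + wt s)"
    by (auto simp: wt_sign_def minus_one_power_iff split: if_splits)
  then show ?thesis
    using wt_plus_zeros[of s] by presburger
qed

lemma sum_zeros:
  fixes S :: "(klein ^ 'n::finite) set"
  shows "(\<Sum>s\<in>S. real (zeros s)) = (\<Sum>i\<in>UNIV. real (card {s \<in> S. s $ i = 0}))"
proof -
  have "(\<Sum>s\<in>S. real (zeros s)) = (\<Sum>s\<in>S. \<Sum>i\<in>UNIV. if s $ i = 0 then 1 else 0)"
    by (simp add: zeros_def sum.If_cases)
  also have "\<dots> = (\<Sum>i\<in>UNIV. \<Sum>s\<in>S. if s $ i = 0 then 1 else 0)"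
    by (rule sum.swap)
  finally show ?thesis
    by (simp add: sum.If_cases Int_def)
qed

text \<open>The square of \<open>zeros s\<close> counts ordered pairs of zero coordinates of
  \<open>s\<close>, including the pairs with both entries equal.\<close>

lemma sum_zeros_square:
  fixes S :: "(klein ^ 'n::finite) set"
  shows "(\<Sum>s\<in>S. real (zeros s) ^ 2)
    = (\<Sum>(i, j)\<in>UNIV. real (card {s \<in> S. s $ i = 0 \<and> s $ j = 0}))"
proof -
  have "real (zeros s) ^ 2
      = (\<Sum>p\<in>UNIV. if s $ fst p = 0 \<and> s $ snd p = 0 then 1 else 0)" for s :: "klein ^ 'n"
  proof -
    have "{p. s $ fst p = 0 \<and> s $ snd p = 0} = {i. s $ i = 0} \<times> {i. s $ i = 0}"
      by auto
    then show ?thesis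
      by (simp add: zeros_def sum.If_cases card_cartesian_product power2_eq_square)
  qed
  then have "(\<Sum>s\<in>S. real (zeros s) ^ 2)
      = (\<Sum>s\<in>S. \<Sum>p\<in>UNIV. if s $ fst p = 0 \<and> s $ snd p = 0 then 1 else 0)"
    by simp
  also have "\<dots> = (\<Sum>p\<in>UNIV. \<Sum>s\<in>S. if s $ fst p = 0 \<and> s $ snd p = 0 then 1 else 0)"
    by (rule sum.swap)
  finally show ?thesis
    by (simp add: sum.If_cases Int_def case_prod_unfold)
qed

section \<open>First and second moments of \<open>zeros\<close> over the shadow\<close>

context
  fixes C :: "(klein ^ 'n::finite) set"
  assumes C: "linear_code C" and sd: "self_dual C" and no_wt_1: "\<forall>x\<in>C. wt x \<noteq> 1"
begin

text \<open>Without codewords of weight 1, only the zero word is supported in a single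
  coordinate.\<close>

lemma card_shadow_vanishing_1:
  "4 * real (card {s \<in> shadow C. s $ i = 0}) = 2 ^ CARD('n)"
proof -
  have "{i. c $ i \<noteq> 0} \<noteq> {i}" if "c \<in> C" for c
    using no_wt_1 that by (force simp: wt_def)
  then have "{c. c \<in> C \<and> {i. c $ i \<noteq> 0} \<subseteq> {i}} = {0}"
    using C by (fastforce simp: linear_code_def vec_eq_iff subset_singleton_iff)
  then show ?thesis
    using card_shadow_vanishing[OF C sd, of "{i}"] by (simp add: wt_sign_def wt_def)
qed

text \<open>A nonzero codeword supported in \<open>{i, j}\<close> has exactly this support, hence
  weight 2 and sign 1.\<close>

lemma card_shadow_vanishing_2:
  assumes "i \<noteq> j"
  shows "16 * real (card {s \<in> shadow C. s $ i = 0 \<and> s $ j = 0})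
    = 2 ^ CARD('n) * (1 + real (card {c \<in> C. {k. c $ k \<noteq> 0} = {i, j}}))"
proof -
  have "{k. c $ k \<noteq> 0} \<noteq> {k}" if "c \<in> C" for c k
    using no_wt_1 that by (force simp: wt_def)
  moreover have "X \<subseteq> {i, j} \<longleftrightarrow> X = {} \<or> X = {i} \<or> X = {j} \<or> X = {i, j}" for X
    by blast
  ultimately have eq: "{c. c \<in> C \<and> {k. c $ k \<noteq> 0} \<subseteq> {i, j}}
      = insert 0 {c \<in> C. {k. c $ k \<noteq> 0} = {i, j}}"
    using C by (auto simp: linear_code_def vec_eq_iff)
  have "wt_sign c = 1" if "{k. c $ k \<noteq> 0} = {i, j}" for c
    using assms that by (simp add: wt_sign_def wt_def)
  then have "(\<Sum>c | c \<in> C \<and> {k. c $ k \<noteq> 0} \<subseteq> {i, j}. wt_sign c)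
      = 1 + real (card {c \<in> C. {k. c $ k \<noteq> 0} = {i, j}})"
    unfolding eq by (subst sum.insert) (auto simp: wt_sign_def wt_def)
  then show ?thesis
    using card_shadow_vanishing[OF C sd, of "{i, j}"] assms by simp
qed

lemma sum_zeros_shadow: "4 * (\<Sum>s\<in>shadow C. real (zeros s)) = real CARD('n) * 2 ^ CARD('n)"
  by (simp add: sum_zeros sum_distrib_left card_shadow_vanishing_1)

text \<open>Each codeword of weight 2 is counted once for each of the two orderings of its
  support.\<close>

lemma sum_card_support_pairs:
  "(\<Sum>(i, j)\<in>{p. fst p \<noteq> snd p}. real (card {c \<in> C. {k. c $ k \<noteq> 0} = {i, j}}))
    = 2 * real (card {c \<in> C. wt c = 2})"
proof -
  let ?P = "{p :: 'n \<times> 'n. fst p \<noteq> snd p}"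
  have "(\<Sum>(i, j)\<in>?P. real (card {c \<in> C. {k. c $ k \<noteq> 0} = {i, j}}))
      = (\<Sum>p\<in>?P. \<Sum>c\<in>C. if {k. c $ k \<noteq> 0} = {fst p, snd p} then 1 else 0)"
    by (simp add: sum.If_cases Int_def case_prod_unfold)
  also have "\<dots> = (\<Sum>c\<in>C. \<Sum>p\<in>?P. if {k. c $ k \<noteq> 0} = {fst p, snd p} then 1 else 0)"
    by (rule sum.swap)
  also have "\<dots> = (\<Sum>c\<in>C. if wt c = 2 then 2 else 0)"
  proof (rule sum.cong[OF refl])
    fix c :: "klein ^ 'n"
    have eq: "(\<Sum>p\<in>?P. if {k. c $ k \<noteq> 0} = {fst p, snd p} then 1 else 0)
        = real (card {p \<in> ?P. {k. c $ k \<noteq> 0} = {fst p, snd p}})"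
      by (simp add: sum.If_cases Int_def)
    show "(\<Sum>p\<in>?P. if {k. c $ k \<noteq> 0} = {fst p, snd p} then 1 else 0)
        = (if wt c = 2 then 2 else (0::real))"
    proof (cases "wt c = 2")
      case True
      then obtain a b where ab: "{k. c $ k \<noteq> 0} = {a, b}" "a \<noteq> b"
        by (auto simp: wt_def card_2_iff)
      have "{p \<in> ?P. {a, b} = {fst p, snd p}} = {(a, b), (b, a)}"
        using ab(2) by (auto simp: doubleton_eq_iff)
      then have "card {p \<in> ?P. {k. c $ k \<noteq> 0} = {fst p, snd p}} = 2"
        unfolding ab(1) using ab(2) by simp
      then show ?thesis
        unfolding eq using True by simp
    next
      case False
      then have "{p \<in> ?P. {k. c $ k \<noteq> 0} = {fst p, snd p}} = {}"
        by (auto simp: wt_def)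
      then show ?thesis
        unfolding eq using False by (simp only: card.empty) simp
    qed
  qed
  also have "\<dots> = 2 * real (card {c \<in> C. wt c = 2})"
    by (simp add: sum.If_cases Int_def)
  finally show ?thesis .
qed

lemma sum_zeros_square_shadow:
  "16 * (\<Sum>s\<in>shadow C. real (zeros s) ^ 2)
    = 2 ^ CARD('n) * (4 * real CARD('n) + real CARD('n) * (real CARD('n) - 1)
        + 2 * real (card {c \<in> C. wt c = 2}))"
proof -
  let ?P = "{p :: 'n \<times> 'n. fst p \<noteq> snd p}" and ?D = "{p :: 'n \<times> 'n. fst p = snd p}"
  let ?g = "\<lambda>p. real (card {s \<in> shadow C. s $ fst p = 0 \<and> s $ snd p = 0})"
  have D: "?D = range (\<lambda>i. (i, i))"
    by auto
  have cD: "card ?D = CARD('n)"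
    unfolding D by (rule card_image) (auto simp: inj_on_def)
  have "?P = UNIV - ?D"
    by auto
  then have "card ?P = card (UNIV :: ('n \<times> 'n) set) - CARD('n)"
    using cD by (metis card_Diff_subset finite subset_UNIV)
  also have "card (UNIV :: ('n \<times> 'n) set) = CARD('n) * CARD('n)"
    by (metis UNIV_Times_UNIV card_cartesian_product)
  finally have cP: "real (card ?P) = real CARD('n) * (real CARD('n) - 1)"
    by (simp add: of_nat_diff algebra_simps)
  have "(\<Sum>s\<in>shadow C. real (zeros s) ^ 2) = sum ?g (?D \<union> ?P)"
    unfolding sum_zeros_square case_prod_unfold by (rule sum.cong) auto
  also have "\<dots> = sum ?g ?D + sum ?g ?P"
    by (rule sum.union_disjoint) auto
  \<comment> \<open>On the diagonal both conditions coincide, so the single-coordinate count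
    applies; it is scaled by 4, and the outer 4 completes the factor 16.\<close>
  finally have "16 * (\<Sum>s\<in>shadow C. real (zeros s) ^ 2)
      = 4 * (\<Sum>p\<in>?D. 4 * ?g p) + (\<Sum>p\<in>?P. 16 * ?g p)"
    by (simp add: sum_distrib_left[symmetric])
  also have "(\<Sum>p\<in>?D. 4 * ?g p) = (\<Sum>p\<in>?D. 2 ^ CARD('n))"
    by (intro sum.cong) (auto simp: card_shadow_vanishing_1)
  also have "\<dots> = real CARD('n) * 2 ^ CARD('n)"
    by (simp add: cD)
  also have "(\<Sum>p\<in>?P. 16 * ?g p) = (\<Sum>p\<in>?P. 2 ^ CARD('n)
      * (1 + real (card {c \<in> C. {k. c $ k \<noteq> 0} = {fst p, snd p}})))"
    by (intro sum.cong) (auto simp: card_shadow_vanishing_2)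
  also have "\<dots> = 2 ^ CARD('n) * (real (card ?P) + 2 * real (card {c \<in> C. wt c = 2}))"
    using sum_card_support_pairs
    by (simp add: sum_distrib_left[symmetric] sum.distrib case_prod_unfold)
  finally show ?thesis
    unfolding cP by (simp add: algebra_simps)
qed

text \<open>Half of 16 times the second moment minus 32 times the first: 4n + n(n - 1) - 8n = -n(5 -
  n).\<close>

lemma sum_zeros_shadow_excess:
  "8 * (\<Sum>s\<in>shadow C. real (zeros s) * (real (zeros s) - 2))
    = 2 ^ CARD('n) * (real (card {c \<in> C. wt c = 2}) - real CARD('n) / 2 * (5 - real CARD('n)))"
proof -
  have "(\<Sum>s\<in>shadow C. real (zeros s) * (real (zeros s) - 2))
      = (\<Sum>s\<in>shadow C. real (zeros s) ^ 2) - 2 * (\<Sum>s\<in>shadow C. real (zeros s))"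
    by (simp add: right_diff_distrib sum_subtractf power2_eq_square sum_distrib_left mult.commute)
  then show ?thesis
    using sum_zeros_shadow sum_zeros_square_shadow by (simp add: algebra_simps)
qed

end

section \<open>The bound, the case of equality, and the count\<close>

theorem theorem14:
  fixes C :: "(klein ^ 'n::finite) set"
  assumes "linear_code C" and "self_dual C"
    and "\<forall>x\<in>C. wt x \<noteq> 1"
  shows "real (card {x\<in>C. wt x = 2}) \<ge> real CARD('n) / 2 * (5 - real CARD('n))
    \<and> (real (card {x\<in>C. wt x = 2}) = real CARD('n) / 2 * (5 - real CARD('n))
         \<longleftrightarrow> int (min_wt (shadow C)) = int CARD('n) - 2)
    \<and> (real (card {x\<in>C. wt x = 2}) = real CARD('n) / 2 * (5 - real CARD('n))
         \<longrightarrow> real (card {x\<in>shadow C. int (wt x) = int CARD('n) - 2})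
               = 2 powi (int CARD('n) - 3) * real CARD('n))"
proof -
  let ?S = "shadow C" and ?n = "real CARD('n)"
  let ?E = "real (card {x \<in> C. wt x = 2}) - ?n / 2 * (5 - ?n)"
  let ?B = "{x \<in> ?S. int (wt x) = int CARD('n) - 2}"
  have excess: "8 * (\<Sum>s\<in>?S. real (zeros s) * (real (zeros s) - 2)) = 2 ^ CARD('n) * ?E"
    by (rule sum_zeros_shadow_excess[OF assms])
  have nonneg: "0 \<le> real (zeros s) * (real (zeros s) - 2)" if "s \<in> ?S" for s
  \<comment> \<open>Among natural numbers Z, the product Z(Z - 2) is negative only at Z = 1, which
    parity excludes.\<close>
  proof (cases "zeros s = 0")
    case False
    moreover have "even (zeros s)"
      by (rule even_zeros_shadow[OF assms(1,2) that])
    ultimately have "2 \<le> zeros s"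
      by presburger
    then show ?thesis
      by simp
  qed simp
  have "0 \<le> 2 ^ CARD('n) * ?E"
    unfolding excess[symmetric] by (simp add: sum_nonneg nonneg)
  then have ge: "0 \<le> ?E"
    unfolding zero_le_mult_iff using zero_less_power[of "2::real" "CARD('n)"] by linarith
  have "?E = 0 \<longleftrightarrow> (\<Sum>s\<in>?S. real (zeros s) * (real (zeros s) - 2)) = 0"
    using arg_cong[OF excess, of "\<lambda>x. x = 0"] by (simp only: mult_eq_0_iff power_eq_0_iff) simp
  also have "\<dots> \<longleftrightarrow> (\<forall>s\<in>?S. zeros s = 0 \<or> zeros s = 2)"
    by (subst sum_nonneg_eq_0_iff) (auto simp: nonneg)
  finally have eq: "?E = 0 \<longleftrightarrow> (\<forall>s\<in>?S. zeros s = 0 \<or> zeros s = 2)" .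
  \<comment> \<open>Working in \<open>int\<close> keeps this valid for n = 1, where both sides are
    false.\<close>
  have wt2: "int (wt x) = int CARD('n) - 2 \<longleftrightarrow> zeros x = 2" for x :: "klein ^ 'n"
    using wt_plus_zeros[of x] by linarith
  have count: "real (card ?B) = 2 powi (int CARD('n) - 3) * ?n" if "?E = 0"
  proof -
    \<comment> \<open>In the case of equality only the vectors with two zeros contribute to the
      first moment, which is known to be n * 2^n / 4.\<close>
    have "(\<Sum>s\<in>?S. real (zeros s)) = (\<Sum>s\<in>?S. if zeros s = 2 then 2 else 0)"
      using that unfolding eq by (intro sum.cong) auto
    also have "\<dots> = 2 * real (card ?B)"
      by (simp add: wt2 sum.If_cases Int_def)
    finally have B: "8 * real (card ?B) = ?n * 2 ^ CARD('n)"
      using sum_zeros_shadow[OF assms] by simp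
    have powi: "2 powi (int CARD('n) - 3) = (2 ^ CARD('n) / 8 :: real)"
      by (simp add: power_int_diff)
    show ?thesis
      unfolding powi using B by (simp add: field_simps)
  qed
  have "?E = 0 \<longleftrightarrow> int (min_wt ?S) = int CARD('n) - 2"
  proof
    assume E: "?E = 0"
    \<comment> \<open>The value from \<open>count\<close> is positive because n is. This rules out
      that all shadow vectors have weight n, so the weight n - 2 is attained.\<close>
    then have "card ?B \<noteq> 0"
      using count by (metis mult_eq_0_iff of_nat_0 of_nat_eq_0_iff power_int_eq_0_iff
          zero_neq_numeral zero_less_card_finite less_irrefl)
    then obtain x where x: "x \<in> ?S" "zeros x = 2"
      unfolding wt2 by (metis (mono_tags, lifting) Collect_empty_eq card.empty)
    have "Min (wt ` ?S) = wt x"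
    proof (rule Min_eqI)
      fix w assume "w \<in> wt ` ?S"
      then obtain y where y: "y \<in> ?S" "w = wt y"
        by blast
      then have "zeros y \<le> 2"
        using E unfolding eq by force
      then show "wt x \<le> w"
        using y x wt_plus_zeros[of x] wt_plus_zeros[of y] by linarith
    qed (use x in auto)
    then show "int (min_wt ?S) = int CARD('n) - 2"
      using x wt2 by (simp add: min_wt_def)
  next
    assume m: "int (min_wt ?S) = int CARD('n) - 2"
    have "zeros s = 0 \<or> zeros s = 2" if s: "s \<in> ?S" for s
    proof -
      \<comment> \<open>Minimal weight n - 2 means at most two zeros, and parity then leaves only 0
        and 2.\<close>
      have "min_wt ?S \<le> wt s"
        unfolding min_wt_def using s by (intro Min_le) auto
      then have "zeros s \<le> 2"
        using m wt_plus_zeros[of s] by linarith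
      then show ?thesis
        using even_zeros_shadow[OF assms(1,2) s] by presburger
    qed
    then show "?E = 0"
      unfolding eq by blast
  qed
  then show ?thesis
    using ge count by auto
qed

end
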